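(* Let $N$ be a positive integer and let $G\le S_N$ be a permutation group. There exist $z_1,\dots,z_{2N}\in\mathbb{N}^N\setminus\{0\}$ such that $f_{z_1},\dots,f_{z_{2N}},\varepsilon_N$ separate $G$-orbits and induce a bi-Lipschitz embedding of $\mathbb{R}^N/G$ (with the quotient metric $d$) into $\mathbb{R}^{2N+1}$, and for such $z_1,\dots,z_{2N}$ the semifield of $G$-invariant tropical rational functions on $\mathbb{R}^N$ is generated by the $3N$ $G$-invariant tropical polynomials $$f_{z_1},\ \dots,\ f_{z_{2N}},\ \varepsilon_1,\ \dots,\ \varepsilon_N.$$ Every generating set of the semifield of $G$-invariant tropical rational functions on $\mathbb{R}^N$ has at least $N$ members.
   Context: $\mathbb{N}=\{0,1,2,\dots\}$. $G\le S_N$ acts on $\mathbb{R}^N$ by permutation matrices (coordinate permutations); $[x]$ is the $G$-orbit of $x$ and $d([x],[y])=\min_{g\in G}\|x-g\cdot y\|_2$. For $z\in\mathbb{R}^N$, $f_z(x):=\max_{g\in G}\langle x,g\cdot z\rangle$. For $k\in\{1,\dots,N\}$, $\varepsilon_k(x):=\max_{\#I=k}\sum_{i\in I}x_i$, the maximum over subsets $I\subseteq\{1,\dots,N\}$ of size $k$. A family of $G$-invariant functions separates $G$-orbits if any two points at which all members of the family agree lie in the same $G$-orbit. A tropical polynomial on $\mathbb{R}^m$ is a finite maximum of functions $z\mapsto\gamma+\langle a,z\rangle$ with $\gamma\in\mathbb{R}$, $a\in\mathbb{Z}_{\ge0}^m$; a tropical rational function is a difference of two tropical polynomials, regarded as a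 function. These form a semifield under $\max$ (addition), $+$ (multiplication), $-$ (division). A set of $G$-invariant tropical rational functions is generating if every $G$-invariant tropical rational $f$ on $\mathbb{R}^N$ equals $g(f_1,\dots,f_k)$ for some members $f_1,\dots,f_k$ of the set and some tropical rational $g$ on $\mathbb{R}^k$. *)

theory Defs
  imports "HOL-Analysis.Analysis" "HOL-Algebra.Bij"
begin

text \<open>
  The space of dimension N is real ^ 'n with N = CARD('n), and a permutation group on N letters is
  a subgroup of the group BijGroup UNIV of all bijections of the index type.
\<close>

definition perm_act :: "('n::finite \<Rightarrow> 'n) \<Rightarrow> real ^ 'n \<Rightarrow> real ^ 'n" where
  "perm_act g x = (\<chi> i. x $ inv_into UNIV g i)"

definition orbit_of :: "('n::finite \<Rightarrow> 'n) set \<Rightarrow> real ^ 'n \<Rightarrow> (real ^ 'n) set" where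
  "orbit_of G x = (\<lambda>g. perm_act g x) ` G"

text \<open>The quotient metric, as a function of representatives of the two orbits.\<close>

definition orbit_dist :: "('n::finite \<Rightarrow> 'n) set \<Rightarrow> real ^ 'n \<Rightarrow> real ^ 'n \<Rightarrow> real" where
  "orbit_dist G x y = Min ((\<lambda>g. norm (x - perm_act g y)) ` G)"

definition invariant_fun :: "('n::finite \<Rightarrow> 'n) set \<Rightarrow> (real ^ 'n \<Rightarrow> real) \<Rightarrow> bool" where
  "invariant_fun G f \<longleftrightarrow> (\<forall>g\<in>G. \<forall>x. f (perm_act g x) = f x)"

definition max_filter :: "('n::finite \<Rightarrow> 'n) set \<Rightarrow> real ^ 'n \<Rightarrow> real ^ 'n \<Rightarrow> real" where
  "max_filter G z x = Max ((\<lambda>g. x \<bullet> perm_act g z) ` G)"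

definition real_vec :: "nat ^ 'n \<Rightarrow> real ^ 'n" where
  "real_vec z = (\<chi> i. real (z $ i))"

definition eps :: "nat \<Rightarrow> real ^ 'n::finite \<Rightarrow> real" where
  "eps k x = Max ((\<lambda>I. \<Sum>i\<in>I. x $ i) ` {I. card I = k})"

definition separates_orbits ::
    "('n::finite \<Rightarrow> 'n) set \<Rightarrow> (real ^ 'n \<Rightarrow> real) set \<Rightarrow> bool" where
  "separates_orbits G F \<longleftrightarrow>
     (\<forall>f\<in>F. invariant_fun G f) \<and>
     (\<forall>x y. (\<forall>f\<in>F. f x = f y) \<longrightarrow> orbit_of G x = orbit_of G y)"

text \<open>
  The tuple (F 1, ..., F m), viewed as a map into Euclidean m-space, induces a bi-Lipschitz
  embedding of the orbit space. It descends to the orbit space by the upper bound, since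
  two points of one orbit are at quotient distance 0.
\<close>

definition bi_lipschitz_on_orbits ::
    "('n::finite \<Rightarrow> 'n) set \<Rightarrow> nat \<Rightarrow> (nat \<Rightarrow> real ^ 'n \<Rightarrow> real) \<Rightarrow> bool" where
  "bi_lipschitz_on_orbits G m F \<longleftrightarrow>
     (\<exists>c>0. \<exists>C>0. \<forall>x y.
        c * orbit_dist G x y \<le> L2_set (\<lambda>j. F j x - F j y) {1..m} \<and>
        L2_set (\<lambda>j. F j x - F j y) {1..m} \<le> C * orbit_dist G x y)"

text \<open>
  Tropical functions in the coordinates indexed by a set I. They read only the
  coordinates in I, so for I = {1..m} they are exactly the tropical functions on
  real m-space, also with respect to equality of functions.
\<close>

definition tropical_polynomial :: "'i set \<Rightarrow> (('i \<Rightarrow> real) \<Rightarrow> real) \<Rightarrow> bool" where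
  "tropical_polynomial I p \<longleftrightarrow>
     (\<exists>T :: (real \<times> ('i \<Rightarrow> nat)) set. finite T \<and> T \<noteq> {} \<and>
        (\<forall>z. p z = Max ((\<lambda>(\<gamma>, a). \<gamma> + (\<Sum>i\<in>I. real (a i) * z i)) ` T)))"

definition tropical_rational :: "'i set \<Rightarrow> (('i \<Rightarrow> real) \<Rightarrow> real) \<Rightarrow> bool" where
  "tropical_rational I f \<longleftrightarrow>
     (\<exists>p q. tropical_polynomial I p \<and> tropical_polynomial I q \<and> (\<forall>z. f z = p z - q z))"

definition inv_tropical_polynomials :: "('n::finite \<Rightarrow> 'n) set \<Rightarrow> (real ^ 'n \<Rightarrow> real) set" where
  "inv_tropical_polynomials G =
     {f. invariant_fun G f \<and> tropical_polynomial UNIV (\<lambda>v. f (\<chi> i. v i))}"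

definition inv_tropical_rationals :: "('n::finite \<Rightarrow> 'n) set \<Rightarrow> (real ^ 'n \<Rightarrow> real) set" where
  "inv_tropical_rationals G =
     {f. invariant_fun G f \<and> tropical_rational UNIV (\<lambda>v. f (\<chi> i. v i))}"

definition generating :: "('n::finite \<Rightarrow> 'n) set \<Rightarrow> (real ^ 'n \<Rightarrow> real) set \<Rightarrow> bool" where
  "generating G S \<longleftrightarrow>
     S \<subseteq> inv_tropical_rationals G \<and>
     (\<forall>f\<in>inv_tropical_rationals G.
        \<exists>k h g. (\<forall>j\<in>{1..k::nat}. h j \<in> S) \<and> tropical_rational {1..k} g \<and>
                (\<forall>x. f x = g (\<lambda>j. h j x)))"

text \<open>The tuple of max filters for z 1, ..., z (2N), followed by the coordinate sum in place 2N + 1.\<close>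

definition filter_bank ::
    "('n::finite \<Rightarrow> 'n) set \<Rightarrow> (nat \<Rightarrow> nat ^ 'n) \<Rightarrow> nat \<Rightarrow> real ^ 'n \<Rightarrow> real" where
  "filter_bank G z j =
     (if j \<le> 2 * CARD('n) then max_filter G (real_vec (z j)) else eps CARD('n))"

definition good_templates :: "('n::finite \<Rightarrow> 'n) set \<Rightarrow> (nat \<Rightarrow> nat ^ 'n) \<Rightarrow> bool" where
  "good_templates G z \<longleftrightarrow>
     (\<forall>j\<in>{1..2 * CARD('n)}. z j \<noteq> 0) \<and>
     separates_orbits G (filter_bank G z ` {1..2 * CARD('n) + 1}) \<and>
     bi_lipschitz_on_orbits G (2 * CARD('n) + 1) (filter_bank G z)"

definition generators ::
    "('n::finite \<Rightarrow> 'n) set \<Rightarrow> (nat \<Rightarrow> nat ^ 'n) \<Rightarrow> (real ^ 'n \<Rightarrow> real) set" where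
  "generators G z =
     (\<lambda>j. max_filter G (real_vec (z j))) ` {1..2 * CARD('n)} \<union> eps ` {1..CARD('n)}"

end

theory Submission
  imports Defs
begin

text \<open>
  Write \<open>N\<close> for the dimension, \<open>f\<^sub>z\<close> for the max filter of \<open>z\<close> and \<open>d\<close> for the orbit distance.

  \<^bold>\<open>Good templates exist.\<close> For all \<open>x\<close>, \<open>y\<close> the difference \<open>f\<^sub>z(x) - f\<^sub>z(y)\<close> is the value at
  \<open>(x, y)\<close> of one of the linear forms \<open>\<langle>x, g z\<rangle> - \<langle>y, h z\<rangle>\<close> with \<open>g\<close>, \<open>h\<close> in the group.
  Fix a choice of such pairs for \<open>z\<^sub>1, ..., z\<^sub>k\<close> and let \<open>W\<close> be the common kernel of the forms.
  If \<open>W\<close> is not contained in the subspace where \<open>g\<^sup>-\<^sup>1 x = h\<^sup>-\<^sup>1 y\<close>, then the form of a further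
  template with this \<open>g\<close>, \<open>h\<close> cuts \<open>W\<close> down by one dimension, as soon as the template avoids a certain
  hyperplane. Only finitely many hyperplanes occur, so vectors of naturals can avoid them all. After
  \<open>2 N\<close> steps each of the kernels, which started with dimension \<open>2 N\<close>, consists of pairs of points
  with the same orbit, matched by one fixed pair of permutations (\<open>ex_templates_kernel_matching\<close>).
  A linear map that vanishes on the common kernel of linear forms is bounded by these forms; this
  bounds \<open>d\<close> by a multiple of \<open>\<Sum>\<^sub>j \<bar>f\<^sub>z\<^sub>j(x) - f\<^sub>z\<^sub>j(y)\<bar>\<close>, which is the lower Lipschitz bound and implies
  separation (\<open>ex_max_filters_lower_lipschitz\<close>). The upper bound holds because tropical rational
  functions are Lipschitz, and invariant ones then are so with respect to \<open>d\<close>.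

  \<^bold>\<open>The generators generate.\<close> The difference \<open>eps k - eps (k - 1)\<close> is the \<open>k\<close>-th largest coordinate.
  For a ranking \<open>\<rho>\<close> of the places let \<open>x\<^sub>\<rho>\<close> be the vector with the coordinates of \<open>x\<close> sorted according to
  \<open>\<rho>\<close>; it depends linearly, with integer coefficients, on the \<open>eps k x\<close>, and \<open>x = x\<^sub>\<rho>\<close> if \<open>\<rho>\<close>
  is the ranking of \<open>x\<close> itself. For invariant tropical rational \<open>f\<close> and a large natural number \<open>m\<close>
  this gives the formula (\<open>generating_generators\<close>)
    \<open>f(x) = Min\<^sub>\<rho> (f(x\<^sub>\<rho>) + m \<Sum>\<^sub>j \<bar>f\<^sub>z\<^sub>j(x) - f\<^sub>z\<^sub>j(x\<^sub>\<rho>)\<bar>)\<close>,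
  whose right hand side is a tropical rational function of the generators. Indeed, \<open>f\<close> is Lipschitz for
  \<open>d\<close> and \<open>d\<close> is bounded by the filter differences, so no term is smaller than \<open>f(x)\<close>, and
  the term of the ranking of \<open>x\<close> is equal to it.

  \<^bold>\<open>The number of generators.\<close> The members of a finite generating set determine the values of all
  \<open>eps k\<close>, which determine \<open>x\<close> within the open set of vectors that are strictly sorted by a fixed
  ranking. They form a continuous injective map on this set, so invariance of dimension bounds their
  number from below by \<open>N\<close> (\<open>card_generating\<close>).
\<close>

section \<open>Tropical functions\<close>

lemma Max_add_Max:
  fixes u :: "'a \<Rightarrow> real" and v :: "'b \<Rightarrow> real"
  assumes "finite A" "A \<noteq> {}" "finite B" "B \<noteq> {}"
  shows "Max (u ` A) + Max (v ` B) = Max ((\<lambda>(s, t). u s + v t) ` (A \<times> B))"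
proof (rule sym, rule Max_eqI)
  have "Max (u ` A) \<in> u ` A" "Max (v ` B) \<in> v ` B"
    using assms by (auto intro!: Max_in)
  then show "Max (u ` A) + Max (v ` B) \<in> (\<lambda>(s, t). u s + v t) ` (A \<times> B)"
    by (auto simp: image_iff) (metis)
qed (use assms in \<open>auto intro!: add_mono\<close>)

lemma abs_diff_Max_le:
  fixes u v :: "'a \<Rightarrow> real"
  assumes "finite A" "A \<noteq> {}" and le: "\<And>t. t \<in> A \<Longrightarrow> \<bar>u t - v t\<bar> \<le> B"
  shows "\<bar>Max (u ` A) - Max (v ` A)\<bar> \<le> B"
proof -
  have "Max (u ` A) \<le> Max (v ` A) + B"
  proof (rule Max.boundedI)
    fix r assume "r \<in> u ` A"
    then obtain t where t: "t \<in> A" "r = u t" by auto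
    have "v t \<le> Max (v ` A)" using t assms by auto
    then show "r \<le> Max (v ` A) + B" using le[OF t(1)] t by auto
  qed (use assms in auto)
  moreover have "Max (v ` A) \<le> Max (u ` A) + B"
  proof (rule Max.boundedI)
    fix r assume "r \<in> v ` A"
    then obtain t where t: "t \<in> A" "r = v t" by auto
    have "u t \<le> Max (u ` A)" using t assms by auto
    then show "r \<le> Max (u ` A) + B" using le[OF t(1)] t by auto
  qed (use assms in auto)
  ultimately show ?thesis by linarith
qed

lemma tropical_polynomial_Max_monomials:
  assumes "finite J" "J \<noteq> {}"
  shows "tropical_polynomial I (\<lambda>z. Max ((\<lambda>j. \<gamma> j + (\<Sum>i\<in>I. real (a j i) * z i)) ` J))"
  unfolding tropical_polynomial_def
  by (rule exI[of _ "(\<lambda>j. (\<gamma> j, a j)) ` J"]) (use assms in \<open>auto simp: image_image\<close>)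

lemma tropical_polynomial_affine:
  "tropical_polynomial I (\<lambda>z. \<gamma> + (\<Sum>i\<in>I. real (a i) * z i))"
  using tropical_polynomial_Max_monomials[of "{()}" I "\<lambda>_. \<gamma>" "\<lambda>_. a"] by simp

lemma tropical_polynomial_const: "tropical_polynomial I (\<lambda>z. \<gamma>)"
  using tropical_polynomial_affine[of I \<gamma> "\<lambda>_. 0"] by simp

lemma tropical_polynomial_coordinate:
  assumes "finite I" "i \<in> I"
  shows "tropical_polynomial I (\<lambda>z. z i)"
proof -
  have "(\<Sum>l\<in>I. real (if l = i then 1 else 0) * z l) = z i" for z :: "'a \<Rightarrow> real"
    using assms by (simp add: if_distrib[of real] if_distrib[of "\<lambda>c. c * _"] cong: if_cong)
  then show ?thesis
    using tropical_polynomial_affine[of I 0 "\<lambda>l. if l = i then 1 else 0"] by simp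
qed

lemma tropical_polynomial_add:
  assumes "tropical_polynomial I p" "tropical_polynomial I q"
  shows "tropical_polynomial I (\<lambda>z. p z + q z)"
proof -
  obtain S T where S: "finite S" "S \<noteq> {}"
      "\<And>z. p z = Max ((\<lambda>(\<gamma>, a). \<gamma> + (\<Sum>i\<in>I. real (a i) * z i)) ` S)"
    and T: "finite T" "T \<noteq> {}"
      "\<And>z. q z = Max ((\<lambda>(\<gamma>, a). \<gamma> + (\<Sum>i\<in>I. real (a i) * z i)) ` T)"
    using assms unfolding tropical_polynomial_def by meson
  have "p z + q z = Max ((\<lambda>j. (fst (fst j) + fst (snd j)) +
      (\<Sum>i\<in>I. real (snd (fst j) i + snd (snd j) i) * z i)) ` (S \<times> T))" for z
    unfolding S(3) T(3) Max_add_Max[OF S(1,2) T(1,2)]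
    by (rule arg_cong[of _ _ Max], rule image_cong)
      (auto simp: sum.distrib algebra_simps)
  then show ?thesis
    using tropical_polynomial_Max_monomials[of "S \<times> T" I "\<lambda>j. fst (fst j) + fst (snd j)"
        "\<lambda>j i. snd (fst j) i + snd (snd j) i"] S T by simp
qed

lemma tropical_polynomial_max:
  assumes "tropical_polynomial I p" "tropical_polynomial I q"
  shows "tropical_polynomial I (\<lambda>z. max (p z) (q z))"
proof -
  obtain S T where S: "finite S" "S \<noteq> {}"
      "\<And>z. p z = Max ((\<lambda>(\<gamma>, a). \<gamma> + (\<Sum>i\<in>I. real (a i) * z i)) ` S)"
    and T: "finite T" "T \<noteq> {}"
      "\<And>z. q z = Max ((\<lambda>(\<gamma>, a). \<gamma> + (\<Sum>i\<in>I. real (a i) * z i)) ` T)"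
    using assms unfolding tropical_polynomial_def by meson
  have "max (p z) (q z) = Max ((\<lambda>(\<gamma>, a). \<gamma> + (\<Sum>i\<in>I. real (a i) * z i)) ` (S \<union> T))" for z
    unfolding S(3) T(3) image_Un by (rule Max_Un[symmetric]) (use S T in auto)
  then show ?thesis
    unfolding tropical_polynomial_def using S T by (intro exI[of _ "S \<union> T"]) auto
qed

lemma tropical_rational_polynomial:
  "tropical_polynomial I p \<Longrightarrow> tropical_rational I p"
  unfolding tropical_rational_def
  by (rule exI[of _ p], rule exI[of _ "\<lambda>_. 0"]) (simp add: tropical_polynomial_const)

lemma tropical_rational_uminus:
  "tropical_rational I f \<Longrightarrow> tropical_rational I (\<lambda>z. - f z)"
  unfolding tropical_rational_def by (metis minus_diff_eq)

lemma tropical_rational_add: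
  assumes "tropical_rational I f" "tropical_rational I g"
  shows "tropical_rational I (\<lambda>z. f z + g z)"
proof -
  obtain p q p' q' where *: "tropical_polynomial I p" "tropical_polynomial I q"
     "tropical_polynomial I p'" "tropical_polynomial I q'"
     "\<And>z. f z = p z - q z" "\<And>z. g z = p' z - q' z"
    using assms unfolding tropical_rational_def by metis
  then show ?thesis
    unfolding tropical_rational_def
    by (intro exI[of _ "\<lambda>z. p z + p' z"] exI[of _ "\<lambda>z. q z + q' z"])
      (simp add: tropical_polynomial_add)
qed

text \<open>Two tropical fractions are put over the common denominator \<open>q + q'\<close>.\<close>

lemma tropical_rational_max:
  assumes "tropical_rational I f" "tropical_rational I g"
  shows "tropical_rational I (\<lambda>z. max (f z) (g z))"
proof -
  obtain p q p' q' where *: "tropical_polynomial I p" "tropical_polynomial I q"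
     "tropical_polynomial I p'" "tropical_polynomial I q'"
     "\<And>z. f z = p z - q z" "\<And>z. g z = p' z - q' z"
    using assms unfolding tropical_rational_def by metis
  have "max (f z) (g z) = max (p z + q' z) (p' z + q z) - (q z + q' z)" for z
    unfolding *(5,6) by linarith
  moreover have "tropical_polynomial I (\<lambda>z. max (p z + q' z) (p' z + q z))"
      "tropical_polynomial I (\<lambda>z. q z + q' z)"
    using * by (auto intro!: tropical_polynomial_add tropical_polynomial_max)
  ultimately show ?thesis unfolding tropical_rational_def by blast
qed

lemma tropical_rational_const: "tropical_rational I (\<lambda>z. \<gamma>)"
  by (intro tropical_rational_polynomial tropical_polynomial_const)

lemma tropical_rational_coordinate:
  "finite I \<Longrightarrow> i \<in> I \<Longrightarrow> tropical_rational I (\<lambda>z. z i)"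
  by (intro tropical_rational_polynomial tropical_polynomial_coordinate)

lemma tropical_rational_diff:
  "tropical_rational I f \<Longrightarrow> tropical_rational I g \<Longrightarrow> tropical_rational I (\<lambda>z. f z - g z)"
  using tropical_rational_add[OF _ tropical_rational_uminus, of I f g] by simp

lemma tropical_rational_abs:
  "tropical_rational I f \<Longrightarrow> tropical_rational I (\<lambda>z. \<bar>f z\<bar>)"
proof -
  assume "tropical_rational I f"
  then have "tropical_rational I (\<lambda>z. max (f z) (- f z))"
    by (intro tropical_rational_max tropical_rational_uminus)
  moreover have "\<bar>f z\<bar> = max (f z) (- f z)" for z by linarith
  ultimately show ?thesis by simp
qed

lemma tropical_rational_sum:
  assumes "\<And>j. j \<in> J \<Longrightarrow> tropical_rational I (f j)"
  shows "tropical_rational I (\<lambda>z. \<Sum>j\<in>J. f j z)"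
  using assms
  by (induction J rule: infinite_finite_induct)
    (simp_all add: tropical_rational_const tropical_rational_add)

lemma tropical_rational_nat_mult:
  "tropical_rational I f \<Longrightarrow> tropical_rational I (\<lambda>z. real m * f z)"
  using tropical_rational_sum[of "{..<m}" I "\<lambda>_. f"] by simp

lemma tropical_rational_Max:
  assumes "finite J" "J \<noteq> {}" "\<And>j. j \<in> J \<Longrightarrow> tropical_rational I (f j)"
  shows "tropical_rational I (\<lambda>z. Max ((\<lambda>j. f j z) ` J))"
  using assms
  by (induction J rule: finite_ne_induct) (simp_all add: tropical_rational_max)

lemma tropical_rational_Min:
  assumes "finite J" "J \<noteq> {}" "\<And>j. j \<in> J \<Longrightarrow> tropical_rational I (f j)"
  shows "tropical_rational I (\<lambda>z. Min ((\<lambda>j. f j z) ` J))"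
proof -
  have "Min ((\<lambda>j. f j z) ` J) = - Max ((\<lambda>j. - f j z) ` J)" for z
    using minus_Max_eq_Min[of "(\<lambda>j. - f j z) ` J"] assms by (simp add: image_image del: minus_Max_eq_Min minus_Min_eq_Max)
  then show ?thesis
    using assms
    by (simp add: tropical_rational_uminus tropical_rational_Max del: minus_Max_eq_Min)
qed

text \<open>The exponents of tropical monomials are natural, so substitution only needs the closure under
  sums, multiples by naturals and finite maxima.\<close>

lemma tropical_rational_compose:
  assumes f: "tropical_rational I f" and h: "\<And>i. i \<in> I \<Longrightarrow> tropical_rational J (h i)"
  shows "tropical_rational J (\<lambda>w. f (\<lambda>i. h i w))"
proof -
  have poly: "tropical_rational J (\<lambda>w. p (\<lambda>i. h i w))" if p: "tropical_polynomial I p" for p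
  proof -
    obtain T where T: "finite T" "T \<noteq> {}"
      "\<And>z. p z = Max ((\<lambda>(\<gamma>, a). \<gamma> + (\<Sum>i\<in>I. real (a i) * z i)) ` T)"
      using p unfolding tropical_polynomial_def by meson
    have "tropical_rational J
        (\<lambda>w. Max ((\<lambda>t. (fst t + (\<Sum>i\<in>I. real (snd t i) * h i w))) ` T))"
      by (intro tropical_rational_Max T tropical_rational_add tropical_rational_sum
          tropical_rational_nat_mult h tropical_rational_const)
    then show ?thesis unfolding T(3) by (simp add: case_prod_beta)
  qed
  obtain p q where "tropical_polynomial I p" "tropical_polynomial I q" "\<And>z. f z = p z - q z"
    using f unfolding tropical_rational_def by metis
  then show ?thesis using poly[of p] poly[of q] by (simp add: tropical_rational_diff)
qed

lemma tropical_rational_cong: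
  assumes "tropical_rational I f" "\<And>i. i \<in> I \<Longrightarrow> z i = w i"
  shows "f z = f w"
proof -
  have "p z = p w" if "tropical_polynomial I p" for p
    using that assms(2) unfolding tropical_polynomial_def
    by (auto simp: case_prod_beta cong: sum.cong)
  then show ?thesis using assms(1) unfolding tropical_rational_def by metis
qed

text \<open>Each monomial is Lipschitz with the norm of its exponent vector as constant.\<close>

lemma tropical_polynomial_lipschitz:
  fixes f :: "real ^ 'n::finite \<Rightarrow> real"
  assumes "tropical_polynomial UNIV (\<lambda>v. f (\<chi> i. v i))"
  shows "\<exists>L\<ge>0. \<forall>x y. \<bar>f x - f y\<bar> \<le> L * norm (x - y)"
proof -
  obtain T where T: "finite T" "T \<noteq> {}"
      "\<And>z. f (\<chi> i. z i) = Max ((\<lambda>(\<gamma>, a). \<gamma> + (\<Sum>i\<in>UNIV. real (a i) * z i)) ` T)"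
    using assms unfolding tropical_polynomial_def by meson
  define vec where "vec = (\<lambda>t :: real \<times> ('n \<Rightarrow> nat). \<chi> i. real (snd t i))"
  have f: "f x = Max ((\<lambda>t. fst t + vec t \<bullet> x) ` T)" for x
    using T(3)[of "\<lambda>i. x $ i"] by (simp add: case_prod_beta vec_def inner_vec_def)
  define L where "L = (\<Sum>t\<in>T. norm (vec t))"
  have "\<bar>f x - f y\<bar> \<le> L * norm (x - y)" for x y
    unfolding f
  proof (rule abs_diff_Max_le[OF T(1,2)])
    fix t assume t: "t \<in> T"
    have "\<bar>(fst t + vec t \<bullet> x) - (fst t + vec t \<bullet> y)\<bar> = \<bar>vec t \<bullet> (x - y)\<bar>"
      by (simp add: inner_diff_right)
    also have "\<dots> \<le> norm (vec t) * norm (x - y)" by (rule Cauchy_Schwarz_ineq2)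
    also have "\<dots> \<le> L * norm (x - y)"
      unfolding L_def using t T(1) by (intro mult_right_mono member_le_sum) auto
    finally show "\<bar>(fst t + vec t \<bullet> x) - (fst t + vec t \<bullet> y)\<bar> \<le> L * norm (x - y)" .
  qed
  moreover have "L \<ge> 0" unfolding L_def by (simp add: sum_nonneg)
  ultimately show ?thesis by blast
qed

lemma tropical_rational_lipschitz:
  fixes f :: "real ^ 'n::finite \<Rightarrow> real"
  assumes "tropical_rational UNIV (\<lambda>v. f (\<chi> i. v i))"
  shows "\<exists>L\<ge>0. \<forall>x y. \<bar>f x - f y\<bar> \<le> L * norm (x - y)"
proof -
  obtain p q where pq: "tropical_polynomial UNIV p" "tropical_polynomial UNIV q"
     "\<And>z. f (\<chi> i. z i) = p z - q z"
    using assms unfolding tropical_rational_def by metis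
  have f: "f x = p (\<lambda>i. x $ i) - q (\<lambda>i. x $ i)" for x
    using pq(3)[of "\<lambda>i. x $ i"] by simp
  have "tropical_polynomial UNIV (\<lambda>v. p (\<lambda>i. (\<chi> i. v i) $ i))"
       "tropical_polynomial UNIV (\<lambda>v. q (\<lambda>i. (\<chi> i. v i) $ i))"
    using pq by simp_all
  from this[THEN tropical_polynomial_lipschitz]
  obtain L M where L: "L \<ge> 0" "\<And>x y :: real ^ 'n. \<bar>p (\<lambda>i. x $ i) - p (\<lambda>i. y $ i)\<bar> \<le> L * norm (x - y)"
    and M: "M \<ge> 0" "\<And>x y :: real ^ 'n. \<bar>q (\<lambda>i. x $ i) - q (\<lambda>i. y $ i)\<bar> \<le> M * norm (x - y)"
    by auto
  have "\<bar>f x - f y\<bar> \<le> (L + M) * norm (x - y)" for x y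
    unfolding f distrib_right using L(2)[of x y] M(2)[of x y] by linarith
  then show ?thesis using L(1) M(1) by (intro exI[of _ "L + M"]) auto
qed

section \<open>Permutation groups and the orbit distance\<close>

text \<open>Reading the coordinates through \<open>g\<close> is the action of the inverse permutation; in this form
  no inverse function appears in the terms.\<close>

definition reindex :: "('n::finite \<Rightarrow> 'n) \<Rightarrow> real ^ 'n \<Rightarrow> real ^ 'n" where
  "reindex g x = (\<chi> i. x $ g i)"

lemma reindex_diff: "reindex g (x - y) = reindex g x - reindex g y"
  by (simp add: reindex_def vec_eq_iff)

lemma linear_reindex: "linear (reindex g)"
  by (auto intro!: linearI simp: reindex_def vec_eq_iff)

lemma perm_act_eq_reindex: "perm_act g = reindex (inv_into UNIV g)"
  by (simp add: perm_act_def reindex_def fun_eq_iff)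

lemma reindex_perm_act: "bij g \<Longrightarrow> reindex g (perm_act g x) = x"
  by (simp add: perm_act_def reindex_def vec_eq_iff bij_is_inj)

lemma norm_reindex: "bij g \<Longrightarrow> norm (reindex g x) = norm x"
  using sum.reindex_bij_betw[of g UNIV UNIV "\<lambda>i. x $ i * x $ i"]
  by (simp add: norm_eq_sqrt_inner inner_vec_def reindex_def)

lemma inner_perm_act: "bij g \<Longrightarrow> x \<bullet> perm_act g z = reindex g x \<bullet> z"
  using sum.reindex_bij_betw[of g UNIV UNIV "\<lambda>i. x $ i * z $ inv_into UNIV g i"]
  by (simp add: inner_vec_def perm_act_def reindex_def bij_is_inj)

lemma perm_act_comp:
  assumes "bij g" "bij h"
  shows "perm_act g (perm_act h x) = perm_act (g \<circ> h) x"
  using assms by (simp add: perm_act_def vec_eq_iff o_inv_distrib)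

lemma perm_act_id: "perm_act (\<lambda>i. i) x = x"
  by (simp add: perm_act_def vec_eq_iff inv_id[unfolded id_def])

locale permutation_group =
  fixes G :: "('n::finite \<Rightarrow> 'n) set"
  assumes subgroup_BijGroup: "subgroup G (BijGroup (UNIV :: 'n set))"
begin

lemma bij_mem: "g \<in> G \<Longrightarrow> bij g"
  using subgroup.subset[OF subgroup_BijGroup] by (auto simp: BijGroup_def Bij_def)

lemma id_mem: "(\<lambda>i. i) \<in> G"
  using subgroup.one_closed[OF subgroup_BijGroup] by (simp add: BijGroup_def restrict_UNIV)

lemma comp_mem: "g \<in> G \<Longrightarrow> h \<in> G \<Longrightarrow> g \<circ> h \<in> G"
proof -
  assume gh: "g \<in> G" "h \<in> G"
  have "g \<in> Bij UNIV" "h \<in> Bij UNIV"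
    using gh subgroup.subset[OF subgroup_BijGroup] by (auto simp: BijGroup_def)
  then show ?thesis
    using subgroup.m_closed[OF subgroup_BijGroup gh]
    by (simp add: BijGroup_def compose_def comp_def restrict_def)
qed

lemma inv_mem:
  assumes "g \<in> G"
  shows "inv_into UNIV g \<in> G"
proof -
  have "g \<in> Bij UNIV"
    using assms subgroup.subset[OF subgroup_BijGroup] by (auto simp: BijGroup_def)
  then show ?thesis
    using subgroup.m_inv_closed[OF subgroup_BijGroup assms] by (simp add: inv_BijGroup restrict_def)
qed

lemma finite_group: "finite G" and nonempty: "G \<noteq> {}"
  using id_mem by auto

lemma perm_act_inv_cancel:
  assumes "g \<in> G"
  shows "perm_act g (perm_act (inv_into UNIV g) x) = x"
proof -
  have "g \<circ> inv_into UNIV g = (\<lambda>i. i)"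
    using bij_mem[OF assms] by (simp add: fun_eq_iff bij_is_surj surj_f_inv_f)
  then show ?thesis
    using assms by (simp add: perm_act_comp bij_mem inv_mem perm_act_id)
qed

lemma orbit_of_perm_act:
  assumes "g \<in> G"
  shows "orbit_of G (perm_act g x) = orbit_of G x"
proof -
  have sub: "orbit_of G (perm_act h y) \<subseteq> orbit_of G y" if "h \<in> G" for h y
    using that by (auto simp: orbit_of_def perm_act_comp bij_mem intro: comp_mem)
  have "orbit_of G x \<subseteq> orbit_of G (perm_act g x)"
    using sub[of "inv_into UNIV g" "perm_act g x"] sub[of g "perm_act (inv_into UNIV g) x"]
      assms inv_mem bij_mem
    by (metis inv_inv_eq perm_act_inv_cancel)
  then show ?thesis using sub[OF assms] by blast
qed

lemma orbit_dist_attained: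
  obtains g where "g \<in> G" "orbit_dist G x y = norm (x - perm_act g y)"
proof -
  have "orbit_dist G x y \<in> (\<lambda>g. norm (x - perm_act g y)) ` G"
    unfolding orbit_dist_def by (rule Min_in) (use finite_group nonempty in auto)
  then show ?thesis using that by auto
qed

lemma orbit_dist_le: "g \<in> G \<Longrightarrow> orbit_dist G x y \<le> norm (x - perm_act g y)"
  unfolding orbit_dist_def using finite_group by auto

lemma orbit_dist_nonneg: "0 \<le> orbit_dist G x y"
  by (metis orbit_dist_attained norm_ge_zero)

lemma orbit_dist_zero_imp_same_orbit:
  assumes "orbit_dist G x y = 0"
  shows "orbit_of G x = orbit_of G y"
proof -
  obtain g where "g \<in> G" "norm (x - perm_act g y) = 0"
    using orbit_dist_attained[of x y] assms by metis
  then show ?thesis using orbit_of_perm_act by auto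
qed

text \<open>The form of the orbit distance that suits pairs of max filters: maximizers \<open>g\<close> for \<open>x\<close> and \<open>h\<close>
  for \<open>y\<close> arise independently of each other.\<close>

lemma orbit_dist_le_reindex:
  assumes "g \<in> G" "h \<in> G"
  shows "orbit_dist G x y \<le> norm (reindex g x - reindex h y)"
proof -
  have h: "bij h" "bij g" using assms bij_mem by auto
  have "reindex h y = perm_act (inv_into UNIV h) y"
    using h by (simp add: perm_act_eq_reindex inv_inv_eq)
  then have "reindex h y = reindex g (perm_act (g \<circ> inv_into UNIV h) y)"
    using h by (simp add: reindex_perm_act bij_imp_bij_inv flip: perm_act_comp)
  then have "norm (reindex g x - reindex h y) = norm (x - perm_act (g \<circ> inv_into UNIV h) y)"
    using h by (simp add: norm_reindex flip: reindex_diff)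
  then show ?thesis
    using orbit_dist_le[of "g \<circ> inv_into UNIV h" x y] assms comp_mem inv_mem by simp
qed

text \<open>Replacing \<open>y\<close> by the point of its orbit nearest to \<open>x\<close> does not change \<open>f y\<close>.\<close>

lemma invariant_tropical_rational_lipschitz:
  assumes "f \<in> inv_tropical_rationals G"
  shows "\<exists>L\<ge>0. \<forall>x y. \<bar>f x - f y\<bar> \<le> L * orbit_dist G x y"
proof -
  have inv: "\<And>g x. g \<in> G \<Longrightarrow> f (perm_act g x) = f x"
    and "tropical_rational UNIV (\<lambda>v. f (\<chi> i. v i))"
    using assms by (auto simp: inv_tropical_rationals_def invariant_fun_def)
  then obtain L where L: "L \<ge> 0" "\<And>x y. \<bar>f x - f y\<bar> \<le> L * norm (x - y)"
    using tropical_rational_lipschitz by blast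
  have "\<bar>f x - f y\<bar> \<le> L * orbit_dist G x y" for x y
  proof -
    obtain g where "g \<in> G" "orbit_dist G x y = norm (x - perm_act g y)"
      by (rule orbit_dist_attained)
    then show ?thesis using L(2)[of x "perm_act g y"] inv[of g y] by simp
  qed
  then show ?thesis using L(1) by blast
qed

lemma inv_tropical_polynomials_subset: "inv_tropical_polynomials G \<subseteq> inv_tropical_rationals G"
  by (auto simp: inv_tropical_polynomials_def inv_tropical_rationals_def
      tropical_rational_polynomial)

section \<open>The generators are invariant tropical polynomials\<close>

lemma max_filter_mem: "max_filter G (real_vec z) \<in> inv_tropical_polynomials G"
proof -
  have "max_filter G (real_vec z) (perm_act h x) = max_filter G (real_vec z) x"
    if h: "h \<in> G" for h x
  proof -
    have *: "perm_act h x \<bullet> perm_act g w = x \<bullet> perm_act (inv_into UNIV h \<circ> g) w"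
      if "g \<in> G" for g w
      using that h
      by (simp add: perm_act_eq_reindex[of h] inner_perm_act[symmetric] bij_imp_bij_inv bij_mem
          perm_act_comp)
    have "(\<lambda>g. inv_into UNIV h \<circ> g) ` G = G"
    proof
      show "G \<subseteq> (\<lambda>g. inv_into UNIV h \<circ> g) ` G"
      proof
        fix g assume "g \<in> G"
        then have "g = inv_into UNIV h \<circ> (h \<circ> g)" "h \<circ> g \<in> G"
          using h by (auto simp: fun_eq_iff bij_is_inj bij_mem comp_mem)
        then show "g \<in> (\<lambda>g. inv_into UNIV h \<circ> g) ` G" by blast
      qed
    qed (use h in \<open>auto intro: comp_mem inv_mem\<close>)
    then have "(\<lambda>g. perm_act h x \<bullet> perm_act g (real_vec z)) ` G
        = (\<lambda>g. x \<bullet> perm_act g (real_vec z)) ` G"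
      using * by (metis (no_types, lifting) image_cong image_image)
    then show ?thesis by (simp add: max_filter_def)
  qed
  moreover have "tropical_polynomial UNIV (\<lambda>v. max_filter G (real_vec z) (\<chi> i. v i))"
  proof -
    have "max_filter G (real_vec z) (\<chi> i. v i) =
       Max ((\<lambda>g. 0 + (\<Sum>i\<in>UNIV. real (z $ inv_into UNIV g i) * v i)) ` G)" for v
      by (simp add: max_filter_def inner_vec_def perm_act_def real_vec_def mult.commute)
    then show ?thesis
      using tropical_polynomial_Max_monomials[OF finite_group nonempty, of UNIV "\<lambda>_. 0"
          "\<lambda>g i. z $ inv_into UNIV g i"] by simp
  qed
  ultimately show ?thesis
    by (auto simp: inv_tropical_polynomials_def invariant_fun_def)
qed

lemma eps_mem:
  assumes "k \<le> CARD('n)"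
  shows "eps k \<in> inv_tropical_polynomials G"
proof -
  have "eps k (perm_act h x) = eps k x" if "h \<in> G" for h :: "'n \<Rightarrow> 'n" and x :: "real ^ 'n"
  proof -
    define h' where "h' = inv_into UNIV h"
    have h': "bij h'" "bij h" using that by (auto simp: bij_mem h'_def bij_imp_bij_inv)
    have sum: "(\<Sum>i\<in>I. perm_act h x $ i) = (\<Sum>i\<in>h' ` I. x $ i)" for I
      using h' by (subst sum.reindex) (auto simp: perm_act_def h'_def intro: inj_on_subset bij_is_inj)
    have "(`) h' ` {I. card I = k} = {I. card I = k}"
    proof
      show "{I. card I = k} \<subseteq> (`) h' ` {I. card I = k}"
      proof
        fix I :: "'n set" assume I: "I \<in> {I. card I = k}"
        have "I = h' ` (h ` I)" using h' by (simp add: h'_def image_image bij_is_inj)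
        moreover have "card (h ` I) = k"
          using I h' by (auto intro!: card_image intro: inj_on_subset[OF bij_is_inj])
        ultimately show "I \<in> (`) h' ` {I. card I = k}" by blast
      qed
    next
      show "(`) h' ` {I. card I = k} \<subseteq> {I. card I = k}"
        using h' by (auto intro!: card_image intro: inj_on_subset bij_is_inj)
    qed
    then have "(\<lambda>I. \<Sum>i\<in>I. perm_act h x $ i) ` {I. card I = k}
       = (\<lambda>I. \<Sum>i\<in>I. x $ i) ` {I. card I = k}"
      unfolding sum by (metis (no_types, lifting) image_cong image_image)
    then show ?thesis by (simp add: eps_def)
  qed
  moreover have "tropical_polynomial UNIV (\<lambda>v. eps k (\<chi> i::'n. v i))"
  proof -
    obtain I :: "'n set" where "card I = k"
      using obtain_subset_with_card_n[OF assms] by metis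
    then have ne: "{I :: 'n set. card I = k} \<noteq> {}" by auto
    have "eps k (\<chi> i. v i) =
       Max ((\<lambda>I. 0 + (\<Sum>i\<in>UNIV. real (of_bool (i \<in> I)) * v i)) ` {I. card I = k})" for v :: "'n \<Rightarrow> real"
      by (simp add: eps_def of_bool_def if_distrib[of real] if_distrib[of "\<lambda>c. c * _"] sum.If_cases
          cong: if_cong)
    then show ?thesis
      using tropical_polynomial_Max_monomials[OF _ ne, of UNIV "\<lambda>_. 0" "\<lambda>I i. of_bool (i \<in> I)"]
      by simp
  qed
  ultimately show ?thesis
    by (auto simp: inv_tropical_polynomials_def invariant_fun_def)
qed

lemma generators_subset: "generators G z \<subseteq> inv_tropical_polynomials G"
  by (auto simp: generators_def max_filter_mem eps_mem)

lemma filter_bank_mem: "filter_bank G z j \<in> inv_tropical_rationals G"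
  using inv_tropical_polynomials_subset max_filter_mem eps_mem
  by (auto simp: filter_bank_def)

end

section \<open>Sorted coordinates\<close>

text \<open>A ranking \<open>\<rho>\<close> of the places sorts \<open>x\<close> in descending order, the place of rank 1 holding a largest
  coordinate. It is built by adding the places from the largest coordinate to the smallest.\<close>

lemma ex_ranking:
  fixes x :: "real ^ 'n::finite"
  shows "\<exists>\<rho>. bij_betw \<rho> UNIV {1..CARD('n)} \<and> (\<forall>i j. \<rho> i \<le> \<rho> j \<longrightarrow> x $ j \<le> x $ i)"
proof -
  have "\<exists>\<rho>. bij_betw \<rho> A {1..card A} \<and> (\<forall>i\<in>A. \<forall>j\<in>A. \<rho> i \<le> \<rho> j \<longrightarrow> x $ j \<le> x $ i)"
    if "finite A" for A :: "'n set"
    using that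
  proof (induction A rule: finite_ranking_induct[where f = "\<lambda>i. - x $ i"])
    case empty
    then show ?case by (simp add: bij_betw_def)
  next
    case (insert a A)
    show ?case
    proof (cases "a \<in> A")
      case True
      then show ?thesis using insert.IH by (simp add: insert_absorb)
    next
      case False
      obtain \<rho> where \<rho>: "bij_betw \<rho> A {1..card A}"
          "\<And>i j. i \<in> A \<Longrightarrow> j \<in> A \<Longrightarrow> \<rho> i \<le> \<rho> j \<Longrightarrow> x $ j \<le> x $ i"
        using insert.IH by blast
      let ?\<rho> = "\<rho>(a := Suc (card A))"
      have "bij_betw ?\<rho> A {1..card A}"
        using bij_betw_cong[of A ?\<rho> \<rho>] \<rho>(1) False by force
      then have "bij_betw ?\<rho> (A \<union> {a}) ({1..card A} \<union> {?\<rho> a})"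
        by (intro notIn_Un_bij_betw) (use False in auto)
      moreover have "{1..card A} \<union> {?\<rho> a} = {1..card (insert a A)}"
        using False insert.hyps(1) by auto
      moreover have "x $ j \<le> x $ i"
        if "i \<in> insert a A" "j \<in> insert a A" "?\<rho> i \<le> ?\<rho> j" for i j
      proof (cases "j = a")
        case True
        then show ?thesis using that(1) insert.hyps(2) by auto
      next
        case j: False
        then have "\<rho> j \<le> card A" using that(2) \<rho>(1) by (auto simp: bij_betw_def)
        then have "i \<noteq> a" using that(3) j by auto
        then show ?thesis using that j \<rho>(2)[of i j] by auto
      qed
      ultimately show ?thesis by (intro exI[of _ ?\<rho>]) (simp del: fun_upd_apply)
    qed
  qed
  from this[of UNIV] show ?thesis by auto
qed

lemma card_ranked_le:
  fixes \<rho> :: "'n::finite \<Rightarrow> nat"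
  assumes "bij_betw \<rho> UNIV {1..CARD('n)}" "k \<le> CARD('n)"
  shows "card {i. \<rho> i \<le> k} = k"
proof -
  have "\<rho> ` {i. \<rho> i \<le> k} = {1..k}"
  proof
    show "{1..k} \<subseteq> \<rho> ` {i. \<rho> i \<le> k}"
    proof
      fix r assume r: "r \<in> {1..k}"
      then have "r \<in> range \<rho>" using assms by (auto simp: bij_betw_def)
      then show "r \<in> \<rho> ` {i. \<rho> i \<le> k}" using r by auto
    qed
  qed (use assms in \<open>auto simp: bij_betw_def\<close>)
  moreover have "inj_on \<rho> {i. \<rho> i \<le> k}"
    using assms by (auto simp: bij_betw_def inj_on_def)
  ultimately show ?thesis using card_image by fastforce
qed

text \<open>Compare the coordinates with the threshold \<open>t\<close>, the \<open>k\<close>-th largest of them: passing from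
  any \<open>I\<close> to the \<open>k\<close> best places gains only nonnegative and loses only nonpositive terms
  \<open>x $ i - t\<close>.\<close>

lemma eps_ranking:
  fixes x :: "real ^ 'n::finite"
  assumes \<rho>: "bij_betw \<rho> UNIV {1..CARD('n)}" and sorted: "\<And>i j. \<rho> i \<le> \<rho> j \<Longrightarrow> x $ j \<le> x $ i"
    and k: "k \<le> CARD('n)"
  shows "eps k x = (\<Sum>i | \<rho> i \<le> k. x $ i)"
  unfolding eps_def
proof (rule Max_eqI)
  let ?F = "{i. \<rho> i \<le> k}"
  show "(\<Sum>i\<in>?F. x $ i) \<in> (\<lambda>I. \<Sum>i\<in>I. x $ i) ` {I. card I = k}"
    using card_ranked_le[OF \<rho> k] by blast
  fix s assume "s \<in> (\<lambda>I. \<Sum>i\<in>I. x $ i) ` {I. card I = k}"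
  then obtain I where I: "card I = k" "s = (\<Sum>i\<in>I. x $ i)" by auto
  show "s \<le> (\<Sum>i\<in>?F. x $ i)"
  proof (cases "k = 0")
    case True
    then have "I = {}" using I by simp
    moreover have "\<rho> i \<noteq> 0" for i using \<rho> by (force simp: bij_betw_def)
    ultimately show ?thesis using I True by (simp del: neq0_conv)
  next
    case False
    then have "k \<in> range \<rho>" using \<rho> k by (auto simp: bij_betw_def)
    then obtain m where m: "\<rho> m = k" by auto
    define t where "t = x $ m"
    have "(\<Sum>i\<in>I. x $ i - t) = (\<Sum>i\<in>I \<inter> ?F. x $ i - t) + (\<Sum>i\<in>I - ?F. x $ i - t)"
      by (metis finite sum.Int_Diff)
    also have "(\<Sum>i\<in>I - ?F. x $ i - t) \<le> 0"
      using sorted[of m] m by (intro sum_nonpos) (auto simp: t_def)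
    also have "(\<Sum>i\<in>I \<inter> ?F. x $ i - t) \<le> (\<Sum>i\<in>?F. x $ i - t)"
      using sorted[of _ m] m by (intro sum_mono2) (auto simp: t_def)
    finally show ?thesis
      using I card_ranked_le[OF \<rho> k] by (simp add: sum_subtractf)
  qed
qed simp

lemma coordinate_eq_eps_diff:
  fixes x :: "real ^ 'n::finite"
  assumes \<rho>: "bij_betw \<rho> UNIV {1..CARD('n)}" and sorted: "\<And>i j. \<rho> i \<le> \<rho> j \<Longrightarrow> x $ j \<le> x $ i"
  shows "x $ i = eps (\<rho> i) x - eps (\<rho> i - 1) x"
proof -
  have i: "1 \<le> \<rho> i" "\<rho> i \<le> CARD('n)" using \<rho> by (auto simp: bij_betw_def)
  have "j = i" if "\<rho> j = \<rho> i" for j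
    using \<rho> that by (auto simp: bij_betw_def inj_on_def)
  then have "{j. \<rho> j \<le> \<rho> i} = insert i {j. \<rho> j \<le> \<rho> i - 1}"
    using i by (auto, metis Suc_pred le_SucE less_eq_Suc_le)
  moreover have "i \<notin> {j. \<rho> j \<le> \<rho> i - 1}" using i by simp
  ultimately show ?thesis
    using i by (simp add: eps_ranking[OF \<rho> sorted])
qed

lemma eps_0: "eps 0 x = 0"
  by (simp add: eps_def)

lemma eps_CARD: "eps CARD('n) (x :: real ^ 'n::finite) = (\<Sum>i\<in>UNIV. x $ i)"
proof -
  have "{I :: 'n set. card I = CARD('n)} = {UNIV}"
    by (metis (mono_tags) Collect_cong card_eq_UNIV_imp_eq_UNIV finite singleton_conv)
  then show ?thesis by (simp add: eps_def)
qed

section \<open>Templates in general position\<close>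

text \<open>The hyperplanes are avoided one after the other. If \<open>z\<close> avoids the old ones but lies in the one
  orthogonal to \<open>u\<close>, where \<open>u $ i \<noteq> 0\<close>, then \<open>M z + axis i 1\<close> leaves the latter for every \<open>M\<close>, and
  enters an old one for at most one \<open>M\<close>.\<close>

lemma ex_nat_vector_not_orthogonal:
  fixes U :: "(real ^ 'n::finite) set"
  assumes "finite U" "0 \<notin> U"
  shows "\<exists>z :: nat ^ 'n. z \<noteq> 0 \<and> (\<forall>u\<in>U. u \<bullet> real_vec z \<noteq> 0)"
  using assms
proof (induction U rule: finite_induct)
  case empty
  have "(\<chi> i. 1) \<noteq> (0 :: nat ^ 'n)" by (simp add: vec_eq_iff)
  then show ?case by blast
next
  case (insert u U)
  then obtain z :: "nat ^ 'n" where z: "z \<noteq> 0" "\<And>v. v \<in> U \<Longrightarrow> v \<bullet> real_vec z \<noteq> 0" by auto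
  show ?case
  proof (cases "u \<bullet> real_vec z = 0")
    case False
    then show ?thesis using z by (intro exI[of _ z]) auto
  next
    case True
    obtain i where i: "u $ i \<noteq> 0" using insert.prems by (auto simp: vec_eq_iff)
    have "finite (\<Union>v\<in>U. {M. real M = - (v $ i) / (v \<bullet> real_vec z)})"
    proof (intro finite_UN_I insert.hyps)
      fix v
      show "finite {M. real M = - (v $ i) / (v \<bullet> real_vec z)}"
        using finite_vimageI[of "{- (v $ i) / (v \<bullet> real_vec z)}" real]
        by (simp add: vimage_def inj_on_def)
    qed
    then obtain M where M: "M \<notin> (\<Union>v\<in>U. {M. real M = - (v $ i) / (v \<bullet> real_vec z)})"
      using ex_new_if_finite infinite_UNIV_nat by blast
    define z' :: "nat ^ 'n" where "z' = (\<chi> l. M * z $ l + (if l = i then 1 else 0))"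
    have "real_vec z' = real M *\<^sub>R real_vec z + axis i 1"
      by (auto simp: z'_def real_vec_def vec_eq_iff axis_def)
    then have inner: "v \<bullet> real_vec z' = real M * (v \<bullet> real_vec z) + v $ i" for v
      by (simp add: inner_add_right inner_axis)
    have "v \<bullet> real_vec z' \<noteq> 0" if "v \<in> U" for v
    proof
      assume "v \<bullet> real_vec z' = 0"
      then have "real M * (v \<bullet> real_vec z) = - (v $ i)" unfolding inner by linarith
      then have "real M = - (v $ i) / (v \<bullet> real_vec z)" using z(2)[OF that] by (simp add: field_simps)
      then show False using M that by blast
    qed
    moreover have "u \<bullet> real_vec z' \<noteq> 0" unfolding inner using True i by simp
    moreover have "z' \<noteq> 0" by (auto simp: z'_def vec_eq_iff intro!: exI[of _ i])
    ultimately show ?thesis by blast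
  qed
qed

text \<open>A vector orthogonal to the common kernel of the \<open>a j\<close> lies in their span.\<close>

lemma inner_bounded_by_inners:
  fixes a :: "'i \<Rightarrow> 'b::euclidean_space"
  assumes "finite J" and "\<And>v. (\<And>j. j \<in> J \<Longrightarrow> a j \<bullet> v = 0) \<Longrightarrow> u \<bullet> v = 0"
  shows "\<exists>C\<ge>0. \<forall>v. \<bar>u \<bullet> v\<bar> \<le> C * (\<Sum>j\<in>J. \<bar>a j \<bullet> v\<bar>)"
proof -
  have "u \<in> (span (a ` J))\<^sup>\<bottom>\<^sup>\<bottom>"
    using assms(2) by (auto simp: orthogonal_comp_def orthogonal_def inner_commute span_base)
  then have "u \<in> span (a ` J)"
    by (simp add: orthogonal_comp_self)
  then show ?thesis
  proof (induction rule: span_induct_alt)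
    case base
    show ?case by (intro exI[of _ 0]) simp
  next
    case (step c b u)
    then obtain C i where C: "C \<ge> 0" "\<And>v. \<bar>u \<bullet> v\<bar> \<le> C * (\<Sum>j\<in>J. \<bar>a j \<bullet> v\<bar>)"
      and i: "i \<in> J" "b = a i" by auto
    have "\<bar>(c *\<^sub>R b + u) \<bullet> v\<bar> \<le> (\<bar>c\<bar> + C) * (\<Sum>j\<in>J. \<bar>a j \<bullet> v\<bar>)" for v
    proof -
      have "\<bar>(c *\<^sub>R b + u) \<bullet> v\<bar> \<le> \<bar>c\<bar> * \<bar>a i \<bullet> v\<bar> + \<bar>u \<bullet> v\<bar>"
        by (simp add: i inner_add_left abs_mult[symmetric])
      also have "\<bar>a i \<bullet> v\<bar> \<le> (\<Sum>j\<in>J. \<bar>a j \<bullet> v\<bar>)"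
        using i assms(1) by (intro member_le_sum) auto
      finally show ?thesis using C(2)[of v] by (simp add: distrib_right mult_left_mono)
    qed
    then show ?case using C(1) by (intro exI[of _ "\<bar>c\<bar> + C"]) auto
  qed
qed

lemma linear_bounded_by_inners:
  fixes a :: "'i \<Rightarrow> 'b::euclidean_space" and \<phi> :: "'b \<Rightarrow> 'c::euclidean_space"
  assumes "finite J" "linear \<phi>" and "\<And>v. (\<And>j. j \<in> J \<Longrightarrow> a j \<bullet> v = 0) \<Longrightarrow> \<phi> v = 0"
  shows "\<exists>C\<ge>0. \<forall>v. norm (\<phi> v) \<le> C * (\<Sum>j\<in>J. \<bar>a j \<bullet> v\<bar>)"
proof -
  have "\<forall>b. \<exists>C\<ge>0. \<forall>v. \<bar>adjoint \<phi> b \<bullet> v\<bar> \<le> C * (\<Sum>j\<in>J. \<bar>a j \<bullet> v\<bar>)"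
    using assms by (intro allI inner_bounded_by_inners) (simp_all add: adjoint_works inner_commute)
  then obtain C where C: "\<And>b. C b \<ge> 0"
      "\<And>b v. \<bar>adjoint \<phi> b \<bullet> v\<bar> \<le> C b * (\<Sum>j\<in>J. \<bar>a j \<bullet> v\<bar>)" by metis
  have "norm (\<phi> v) \<le> (\<Sum>b\<in>Basis. C b) * (\<Sum>j\<in>J. \<bar>a j \<bullet> v\<bar>)" for v
  proof -
    have "norm (\<phi> v) \<le> (\<Sum>b\<in>Basis. \<bar>\<phi> v \<bullet> b\<bar>)" by (rule norm_le_l1)
    also have "\<dots> \<le> (\<Sum>b\<in>Basis. C b * (\<Sum>j\<in>J. \<bar>a j \<bullet> v\<bar>))"
      using C(2)[of _ v] assms(2) by (intro sum_mono) (simp add: adjoint_works inner_commute)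
    finally show ?thesis by (simp add: sum_distrib_right)
  qed
  then show ?thesis using C(1) by (intro exI[of _ "\<Sum>b\<in>Basis. C b"]) (auto intro: sum_nonneg)
qed

text \<open>As a linear form on pairs \<open>(x, y)\<close> this is \<open>\<langle>x, g w\<rangle> - \<langle>y, h w\<rangle>\<close>, the difference of the max filters
  with template \<open>w\<close> at \<open>x\<close> and \<open>y\<close> whenever \<open>g\<close> and \<open>h\<close> attain the two maxima.\<close>

definition template_pair ::
    "('n::finite \<Rightarrow> 'n) \<times> ('n \<Rightarrow> 'n) \<Rightarrow> nat ^ 'n \<Rightarrow> (real ^ 'n) \<times> (real ^ 'n)" where
  "template_pair s w = (perm_act (fst s) (real_vec w), - perm_act (snd s) (real_vec w))"

definition template_kernel ::
    "(nat \<Rightarrow> ('n::finite \<Rightarrow> 'n) \<times> ('n \<Rightarrow> 'n)) \<Rightarrow> (nat \<Rightarrow> nat ^ 'n) \<Rightarrow> nat \<Rightarrow>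
      ((real ^ 'n) \<times> (real ^ 'n)) set" where
  "template_kernel s z k = {v. \<forall>j\<in>{1..k}. template_pair (s j) (z j) \<bullet> v = 0}"

definition matching_pairs ::
    "('n::finite \<Rightarrow> 'n) \<times> ('n \<Rightarrow> 'n) \<Rightarrow> ((real ^ 'n) \<times> (real ^ 'n)) set" where
  "matching_pairs r = {v. reindex (fst r) (fst v) = reindex (snd r) (snd v)}"

lemma template_pair_inner:
  assumes "bij (fst r)" "bij (snd r)"
  shows "template_pair r w \<bullet> v
    = (reindex (fst r) (fst v) - reindex (snd r) (snd v)) \<bullet> real_vec w"
  using assms inner_perm_act[of "fst r" "fst v"] inner_perm_act[of "snd r" "snd v"]
  by (simp add: template_pair_def inner_prod_def inner_commute inner_diff_right)

lemma template_kernel_Suc: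
  "template_kernel s z (Suc k)
    = template_kernel s z k \<inter> {v. template_pair (s (Suc k)) (z (Suc k)) \<bullet> v = 0}"
  by (auto simp: template_kernel_def atLeastAtMostSuc_conv)

lemma subspace_template_kernel: "subspace (template_kernel s z k)"
  by (auto simp: subspace_def template_kernel_def inner_add_right)

context permutation_group
begin

text \<open>Each new template must lower the dimension of every kernel that does not yet consist of
  matching pairs. For a choice \<open>s\<close> of pairs so far and a further pair \<open>r\<close>, it suffices that the
  template is not orthogonal to one fixed nonzero difference \<open>g\<^sup>-\<^sup>1 x - h\<^sup>-\<^sup>1 y\<close> with \<open>(x, y)\<close> in the
  kernel of \<open>s\<close> and \<open>r = (g, h)\<close>.\<close>

lemma ex_generic_templates:
  "\<exists>z :: nat \<Rightarrow> nat ^ 'n. (\<forall>j\<in>{1..k}. z j \<noteq> 0) \<and>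
     (\<forall>s \<in> {1..k} \<rightarrow>\<^sub>E G \<times> G. (\<exists>r \<in> G \<times> G. template_kernel s z k \<subseteq> matching_pairs r) \<or>
        dim (template_kernel s z k) + k \<le> 2 * CARD('n))"
proof (induction k)
  case 0
  have "template_kernel s z 0 = UNIV" for s :: "nat \<Rightarrow> ('n \<Rightarrow> 'n) \<times> ('n \<Rightarrow> 'n)" and z
    by (simp add: template_kernel_def)
  then show ?case by simp
next
  case (Suc k)
  then obtain z :: "nat \<Rightarrow> nat ^ 'n" where
    *: "(\<forall>j\<in>{1..k}. z j \<noteq> 0) \<and> (\<forall>s \<in> {1..k} \<rightarrow>\<^sub>E G \<times> G.
        (\<exists>r \<in> G \<times> G. template_kernel s z k \<subseteq> matching_pairs r) \<or>
        dim (template_kernel s z k) + k \<le> 2 * CARD('n))" ..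
  note z = bspec[OF conjunct1[OF *]] and IH = bspec[OF conjunct2[OF *]]
  define D where "D = (\<lambda>(s, r). {reindex (fst r) (fst v) - reindex (snd r) (snd v) |v.
      v \<in> template_kernel s z k} - {0})"
  define B where "B = {(s, r). s \<in> {1..k} \<rightarrow>\<^sub>E G \<times> G \<and> r \<in> G \<times> G \<and> D (s, r) \<noteq> {}}"
  define pick where "pick b = (SOME u. u \<in> D b)" for b
  have pick: "pick b \<in> D b" if "b \<in> B" for b
    unfolding pick_def using that by (auto simp: B_def some_in_eq)
  have "B \<subseteq> ({1..k} \<rightarrow>\<^sub>E G \<times> G) \<times> (G \<times> G)" by (auto simp: B_def)
  then have "finite B"
    by (rule finite_subset) (auto intro!: finite_PiE finite_cartesian_product finite_group)
  moreover have "0 \<notin> pick ` B"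
    using pick by (force simp: D_def)
  ultimately obtain w :: "nat ^ 'n" where w: "w \<noteq> 0" "\<And>b. b \<in> B \<Longrightarrow> pick b \<bullet> real_vec w \<noteq> 0"
    using ex_nat_vector_not_orthogonal[of "pick ` B"] by auto
  define z' where "z' = z(Suc k := w)"
  have "(\<exists>r \<in> G \<times> G. template_kernel s z' (Suc k) \<subseteq> matching_pairs r) \<or>
        dim (template_kernel s z' (Suc k)) + Suc k \<le> 2 * CARD('n)"
    if s: "s \<in> {1..Suc k} \<rightarrow>\<^sub>E G \<times> G" for s
  proof -
    define s0 where "s0 = restrict s {1..k}"
    have s0: "s0 \<in> {1..k} \<rightarrow>\<^sub>E G \<times> G" using s by (auto simp: s0_def PiE_iff)
    define r where "r = s (Suc k)"
    have r: "r \<in> G \<times> G" using s by (auto simp: r_def PiE_iff)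
    define W where "W = template_kernel s0 z k"
    have "template_kernel s z' k = W"
      by (auto simp: W_def template_kernel_def s0_def z'_def)
    then have W': "template_kernel s z' (Suc k) = W \<inter> {v. template_pair r w \<bullet> v = 0}"
      by (simp add: template_kernel_Suc r_def z'_def)
    show ?thesis
    proof (cases "W \<subseteq> matching_pairs r")
      case True
      then show ?thesis using r W' by blast
    next
      case False
      then have b: "(s0, r) \<in> B"
        using s0 r by (fastforce simp: B_def D_def W_def matching_pairs_def)
      then obtain v where v: "v \<in> W"
          "pick (s0, r) = reindex (fst r) (fst v) - reindex (snd r) (snd v)"
        using pick[OF b] by (auto simp: D_def W_def)
      have "template_pair r w \<bullet> v \<noteq> 0"
        using w(2)[OF b] r v by (auto simp: template_pair_inner bij_mem mem_Times_iff)
      then have "W \<inter> {v. template_pair r w \<bullet> v = 0} \<subset> W" using v by blast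
      then have "dim (template_kernel s z' (Suc k)) < dim W"
        using subspace_template_kernel[of s z' "Suc k"] subspace_template_kernel[of s0 z k]
        by (intro dim_psubset) (simp add: W' W_def[symmetric] span_eq_iff[THEN iffD2])
      then show ?thesis using IH[OF s0] W' unfolding W_def[symmetric] by auto
    qed
  qed
  moreover have "z' j \<noteq> 0" if "j \<in> {1..Suc k}" for j
    using that z w(1) by (auto simp: z'_def)
  ultimately show ?case by (intro exI[of _ z'] conjI ballI) simp_all
qed

text \<open>With \<open>2 N\<close> templates the second alternative above leaves only the kernel \<open>{0}\<close>, and the pair
  \<open>(0, 0)\<close> is matched by the identity.\<close>

lemma ex_templates_kernel_matching:
  "\<exists>z :: nat \<Rightarrow> nat ^ 'n. (\<forall>j\<in>{1..2 * CARD('n)}. z j \<noteq> 0) \<and>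
     (\<forall>s \<in> {1..2 * CARD('n)} \<rightarrow>\<^sub>E G \<times> G. \<exists>r \<in> G \<times> G.
        template_kernel s z (2 * CARD('n)) \<subseteq> matching_pairs r)"
proof -
  let ?k = "2 * CARD('n)"
  from ex_generic_templates[of ?k] obtain z :: "nat \<Rightarrow> nat ^ 'n" where
    *: "(\<forall>j\<in>{1..?k}. z j \<noteq> 0) \<and> (\<forall>s \<in> {1..?k} \<rightarrow>\<^sub>E G \<times> G.
        (\<exists>r \<in> G \<times> G. template_kernel s z ?k \<subseteq> matching_pairs r) \<or>
        dim (template_kernel s z ?k) + ?k \<le> ?k)" ..
  note z = conjunct1[OF *] and gen = bspec[OF conjunct2[OF *]]
  have "\<exists>r \<in> G \<times> G. template_kernel s z ?k \<subseteq> matching_pairs r" if "dim (template_kernel s z ?k) = 0" for s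
  proof -
    have "template_kernel s z ?k \<subseteq> {0}" using that by simp
    then have "template_kernel s z ?k \<subseteq> matching_pairs (\<lambda>i. i, \<lambda>i. i)"
      by (auto simp: matching_pairs_def)
    then show ?thesis using id_mem by blast
  qed
  moreover have "dim (template_kernel s z ?k) = 0" if "dim (template_kernel s z ?k) + ?k \<le> ?k" for s
    using that by linarith
  ultimately have "\<exists>r \<in> G \<times> G. template_kernel s z ?k \<subseteq> matching_pairs r" if "s \<in> {1..?k} \<rightarrow>\<^sub>E G \<times> G" for s
    using gen[OF that] by metis
  then show ?thesis using z by (intro exI[of _ z] conjI ballI) simp_all
qed

lemma max_filter_attained:
  obtains g where "g \<in> G" "max_filter G z x = x \<bullet> perm_act g z"
proof -
  have "max_filter G z x \<in> (\<lambda>g. x \<bullet> perm_act g z) ` G"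
    unfolding max_filter_def by (rule Max_in) (use finite_group nonempty in auto)
  then show ?thesis using that by auto
qed

text \<open>The maximizers at \<open>x\<close> and at \<open>y\<close> select a choice \<open>s\<close> of pairs, for which the filter differences
  are linear forms in \<open>(x, y)\<close>. There are finitely many choices, so one constant serves them all.\<close>

lemma ex_max_filters_lower_lipschitz:
  "\<exists>z :: nat \<Rightarrow> nat ^ 'n. (\<forall>j\<in>{1..2 * CARD('n)}. z j \<noteq> 0) \<and>
     (\<exists>C>0. \<forall>x y. orbit_dist G x y \<le> C * (\<Sum>j\<in>{1..2 * CARD('n)}.
        \<bar>max_filter G (real_vec (z j)) x - max_filter G (real_vec (z j)) y\<bar>))"
proof -
  let ?k = "2 * CARD('n)"
  let ?S = "{1..?k} \<rightarrow>\<^sub>E G \<times> G"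
  obtain z :: "nat \<Rightarrow> nat ^ 'n" where z: "\<forall>j\<in>{1..?k}. z j \<noteq> 0"
    and "\<forall>s\<in>?S. \<exists>r \<in> G \<times> G. template_kernel s z ?k \<subseteq> matching_pairs r"
    using ex_templates_kernel_matching by blast
  then obtain r where r: "\<And>s. s \<in> ?S \<Longrightarrow> r s \<in> G \<times> G"
      "\<And>s. s \<in> ?S \<Longrightarrow> template_kernel s z ?k \<subseteq> matching_pairs (r s)"
    by metis
  define \<phi> where "\<phi> s v = reindex (fst (r s)) (fst v) - reindex (snd (r s)) (snd v)" for s v
  have lin: "linear (\<phi> s)" for s
    unfolding \<phi>_def
    by (intro linear_compose_sub linear_compose[OF _ linear_reindex, unfolded comp_def]
        linear_fst linear_snd)
  have zero: "\<phi> s v = 0" if "s \<in> ?S" "\<And>j. j \<in> {1..?k} \<Longrightarrow> template_pair (s j) (z j) \<bullet> v = 0" for s v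
  proof -
    have "v \<in> template_kernel s z ?k" using that(2) by (simp add: template_kernel_def)
    then show ?thesis using r(2)[OF that(1)] by (auto simp: \<phi>_def matching_pairs_def)
  qed
  have "\<forall>s\<in>?S. \<exists>C\<ge>0. \<forall>v. norm (\<phi> s v)
      \<le> C * (\<Sum>j\<in>{1..?k}. \<bar>template_pair (s j) (z j) \<bullet> v\<bar>)"
    by (rule ballI, rule linear_bounded_by_inners[OF finite_atLeastAtMost lin zero])
  from bchoice[OF this] obtain C where *: "\<forall>s\<in>?S. C s \<ge> 0 \<and> (\<forall>v. norm (\<phi> s v)
      \<le> C s * (\<Sum>j\<in>{1..?k}. \<bar>template_pair (s j) (z j) \<bullet> v\<bar>))" ..
  note C = conjunct1[OF bspec[OF *]] spec[OF conjunct2[OF bspec[OF *]]]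
  have fin: "finite ?S" by (auto intro!: finite_PiE finite_cartesian_product finite_group)
  define D where "D = 1 + (\<Sum>s\<in>?S. C s)"
  have "D > 0" using C(1) by (simp add: D_def add_pos_nonneg sum_nonneg)
  moreover have "orbit_dist G x y \<le> D * (\<Sum>j\<in>{1..?k}.
        \<bar>max_filter G (real_vec (z j)) x - max_filter G (real_vec (z j)) y\<bar>)" (is "_ \<le> D * ?R") for x y
  proof -
    have "\<forall>j. \<exists>t\<in>G \<times> G. max_filter G (real_vec (z j)) x - max_filter G (real_vec (z j)) y
        = template_pair t (z j) \<bullet> (x, y)"
    proof
      fix j
      obtain g h where "g \<in> G" "max_filter G (real_vec (z j)) x = x \<bullet> perm_act g (real_vec (z j))"
          "h \<in> G" "max_filter G (real_vec (z j)) y = y \<bullet> perm_act h (real_vec (z j))"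
        by (metis max_filter_attained)
      then show "\<exists>t\<in>G \<times> G. max_filter G (real_vec (z j)) x - max_filter G (real_vec (z j)) y
          = template_pair t (z j) \<bullet> (x, y)"
        by (intro bexI[of _ "(g, h)"]) (auto simp: template_pair_def inner_prod_def inner_commute)
    qed
    then obtain t where t: "\<And>j. t j \<in> G \<times> G"
        "\<And>j. max_filter G (real_vec (z j)) x - max_filter G (real_vec (z j)) y
        = template_pair (t j) (z j) \<bullet> (x, y)" by metis
    define s where "s = restrict t {1..?k}"
    have s: "s \<in> ?S" using t by (auto simp: s_def)
    have "orbit_dist G x y \<le> norm (\<phi> s (x, y))"
      using orbit_dist_le_reindex[of "fst (r s)" "snd (r s)" x y] r(1)[OF s]
      by (simp add: \<phi>_def mem_Times_iff)
    also have "\<dots> \<le> C s * (\<Sum>j\<in>{1..?k}. \<bar>template_pair (s j) (z j) \<bullet> (x, y)\<bar>)"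
      by (rule C(2)[OF s])
    also have "(\<Sum>j\<in>{1..?k}. \<bar>template_pair (s j) (z j) \<bullet> (x, y)\<bar>) = ?R"
      by (intro sum.cong) (simp_all add: t s_def)
    also have "C s * ?R \<le> D * ?R"
    proof (rule mult_right_mono)
      have "C s \<le> (\<Sum>s\<in>?S. C s)" using fin C(1) s by (intro member_le_sum) auto
      then show "C s \<le> D" by (simp add: D_def)
    qed (simp add: sum_nonneg)
    finally show ?thesis .
  qed
  ultimately show ?thesis using z by (intro exI[of _ z] conjI exI[of _ D] allI)
qed

lemma ex_good_templates: "\<exists>z :: nat \<Rightarrow> nat ^ 'n. good_templates G z"
proof -
  let ?k = "2 * CARD('n)"
  obtain z :: "nat \<Rightarrow> nat ^ 'n" and C where z: "\<forall>j\<in>{1..?k}. z j \<noteq> 0" and "C > 0"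
    and C: "\<And>x y. orbit_dist G x y \<le> C * (\<Sum>j\<in>{1..?k}.
        \<bar>max_filter G (real_vec (z j)) x - max_filter G (real_vec (z j)) y\<bar>)"
    using ex_max_filters_lower_lipschitz by blast
  let ?F = "filter_bank G z"
  let ?N = "\<lambda>x y. L2_set (\<lambda>j. ?F j x - ?F j y) {1..?k + 1}"
  have lower: "orbit_dist G x y \<le> C * real ?k * ?N x y" for x y
  proof -
    have "(\<Sum>j\<in>{1..?k}. \<bar>max_filter G (real_vec (z j)) x - max_filter G (real_vec (z j)) y\<bar>)
      \<le> (\<Sum>j\<in>{1..?k}. ?N x y)"
    proof (rule sum_mono)
      fix j assume j: "j \<in> {1..?k}"
      have "\<bar>?F j x - ?F j y\<bar> \<le> L2_set (\<lambda>j. \<bar>?F j x - ?F j y\<bar>) {1..?k + 1}"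
        using j by (intro member_le_L2_set) auto
      then show "\<bar>max_filter G (real_vec (z j)) x - max_filter G (real_vec (z j)) y\<bar> \<le> ?N x y"
        using j by (simp add: filter_bank_def L2_set_def)
    qed
    then have "(\<Sum>j\<in>{1..?k}. \<bar>max_filter G (real_vec (z j)) x - max_filter G (real_vec (z j)) y\<bar>)
      \<le> real ?k * ?N x y" by simp
    then have "C * (\<Sum>j\<in>{1..?k}. \<bar>max_filter G (real_vec (z j)) x - max_filter G (real_vec (z j)) y\<bar>)
      \<le> C * (real ?k * ?N x y)" using \<open>C > 0\<close> by (intro mult_left_mono) auto
    then show ?thesis using C[of x y] by (simp add: mult.assoc)
  qed
  have "\<forall>j. \<exists>L\<ge>0. \<forall>x y. \<bar>?F j x - ?F j y\<bar> \<le> L * orbit_dist G x y"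
    by (intro allI invariant_tropical_rational_lipschitz filter_bank_mem)
  then obtain L where L: "\<And>j. L j \<ge> 0" "\<And>j x y. \<bar>?F j x - ?F j y\<bar> \<le> L j * orbit_dist G x y"
    by metis
  define M where "M = 1 + (\<Sum>j\<in>{1..?k + 1}. L j)"
  have "M > 0" using L(1) by (simp add: M_def add_pos_nonneg sum_nonneg)
  have upper: "?N x y \<le> M * orbit_dist G x y" for x y
  proof -
    have "?N x y \<le> (\<Sum>j\<in>{1..?k + 1}. \<bar>?F j x - ?F j y\<bar>)" by (rule L2_set_le_sum_abs)
    also have "\<dots> \<le> (\<Sum>j\<in>{1..?k + 1}. L j * orbit_dist G x y)" by (intro sum_mono L)
    also have "\<dots> \<le> M * orbit_dist G x y"
      using orbit_dist_nonneg[of x y] by (simp only: M_def sum_distrib_right[symmetric] distrib_right)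
    finally show ?thesis .
  qed
  define c where "c = 1 / (C * real ?k)"
  have pos: "C * real ?k > 0" using \<open>C > 0\<close> by simp
  then have "c > 0" by (simp add: c_def)
  moreover have "c * orbit_dist G x y \<le> ?N x y" for x y
    using lower[of x y] pos by (simp add: c_def field_simps)
  ultimately have "bi_lipschitz_on_orbits G (?k + 1) ?F"
    unfolding bi_lipschitz_on_orbits_def using \<open>M > 0\<close> upper by blast
  moreover have "separates_orbits G (?F ` {1..?k + 1})"
    unfolding separates_orbits_def
  proof (intro conjI ballI allI impI)
    show "invariant_fun G f" if "f \<in> ?F ` {1..?k + 1}" for f
      using that filter_bank_mem by (auto simp: inv_tropical_rationals_def)
    fix x y assume "\<forall>f \<in> ?F ` {1..?k + 1}. f x = f y"
    then have "?N x y = 0" by (simp add: L2_set_def)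
    then have "orbit_dist G x y = 0" using lower[of x y] orbit_dist_nonneg[of x y] by simp
    then show "orbit_of G x = orbit_of G y" by (rule orbit_dist_zero_imp_same_orbit)
  qed
  ultimately show ?thesis using z by (auto simp: good_templates_def)
qed

end

section \<open>Generation by max filters and sorted coordinates\<close>

text \<open>If \<open>e\<close> lists the values \<open>eps k x\<close>, then \<open>arrange \<rho> e\<close> holds the \<open>k\<close>-th largest coordinate of \<open>x\<close>
  at the place of rank \<open>k\<close>.\<close>

definition arrange :: "('n::finite \<Rightarrow> nat) \<Rightarrow> (nat \<Rightarrow> real) \<Rightarrow> real ^ 'n" where
  "arrange \<rho> e = (\<chi> i. e (\<rho> i) - e (\<rho> i - 1))"

lemma sum_arrange:
  fixes \<rho> :: "'n::finite \<Rightarrow> nat"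
  assumes "bij_betw \<rho> UNIV {1..CARD('n)}"
  shows "(\<Sum>i\<in>UNIV. arrange \<rho> e $ i) = e CARD('n) - e 0"
proof -
  have "(\<Sum>i\<in>UNIV. arrange \<rho> e $ i) = (\<Sum>k\<in>{1..CARD('n)}. e k - e (k - 1))"
    using sum.reindex_bij_betw[OF assms, of "\<lambda>k. e k - e (k - 1)"] by (simp add: arrange_def)
  also have "\<dots> = e CARD('n) - e 0"
    using sum_telescope''[of 0 "CARD('n)" e] by simp
  finally show ?thesis .
qed

lemma finite_rankings: "finite {\<rho> :: 'n::finite \<Rightarrow> nat. bij_betw \<rho> UNIV {1..CARD('n)}}"
proof (rule finite_subset)
  show "{\<rho> :: 'n \<Rightarrow> nat. bij_betw \<rho> UNIV {1..CARD('n)}} \<subseteq> UNIV \<rightarrow>\<^sub>E {1..CARD('n)}"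
    by (auto simp: bij_betw_def)
  show "finite ((UNIV :: 'n set) \<rightarrow>\<^sub>E {1..CARD('n)})" by (intro finite_PiE) auto
qed

context permutation_group
begin

text \<open>Orbits with the same coordinate sum are told apart by the max filters alone. This is how good
  templates enter the generation theorem: a vector and its rearrangements have the same sum.\<close>

lemma orbit_dist_le_filter_diffs:
  assumes "good_templates G z"
  obtains C where "C \<ge> 0" "\<And>x y. eps CARD('n) x = eps CARD('n) y \<Longrightarrow>
    orbit_dist G x y \<le> C * (\<Sum>j\<in>{1..2 * CARD('n)}.
        \<bar>max_filter G (real_vec (z j)) x - max_filter G (real_vec (z j)) y\<bar>)"
proof -
  let ?k = "2 * CARD('n)"
  let ?F = "filter_bank G z"
  obtain c where c: "c > 0"
      "\<And>x y. c * orbit_dist G x y \<le> L2_set (\<lambda>j. ?F j x - ?F j y) {1..?k + 1}"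
    using assms unfolding good_templates_def bi_lipschitz_on_orbits_def by blast
  show ?thesis
  proof (rule that[of "1 / c"])
    fix x y :: "real ^ 'n"
    assume eq: "eps CARD('n) x = eps CARD('n) y"
    have "c * orbit_dist G x y \<le> (\<Sum>j\<in>{1..?k + 1}. \<bar>?F j x - ?F j y\<bar>)"
      using c(2) L2_set_le_sum_abs order_trans by blast
    also have "\<dots> = (\<Sum>j\<in>{1..?k}. \<bar>?F j x - ?F j y\<bar>)"
      using eq by (simp add: filter_bank_def)
    also have "\<dots> = (\<Sum>j\<in>{1..?k}.
        \<bar>max_filter G (real_vec (z j)) x - max_filter G (real_vec (z j)) y\<bar>)"
      by (intro sum.cong) (auto simp: filter_bank_def)
    finally show "orbit_dist G x y \<le> 1 / c * (\<Sum>j\<in>{1..?k}.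
        \<bar>max_filter G (real_vec (z j)) x - max_filter G (real_vec (z j)) y\<bar>)"
      using c(1) by (simp add: field_simps)
  qed (use c(1) in simp)
qed

text \<open>In terms of the list \<open>w\<close> of generator values, \<open>e w\<close> recovers the values \<open>eps k x\<close>, \<open>piece \<rho>\<close> is the
  term of the ranking \<open>\<rho>\<close> in the formula for \<open>f\<close>, and \<open>g\<close> is the minimum of these terms. The weight \<open>m\<close>
  is at least a Lipschitz constant of \<open>f\<close> with respect to the filter differences; it is natural so
  that the pieces are tropical.\<close>

lemma generating_generators:
  assumes good: "good_templates G z"
  shows "generating G (generators G z)"
  unfolding generating_def
proof (intro conjI ballI)
  show "generators G z \<subseteq> inv_tropical_rationals G"
    using generators_subset inv_tropical_polynomials_subset by blast
next
  fix f assume f: "f \<in> inv_tropical_rationals G"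
  let ?N = "CARD('n)"
  let ?R = "{\<rho> :: 'n \<Rightarrow> nat. bij_betw \<rho> UNIV {1..?N}}"
  let ?f = "\<lambda>j. max_filter G (real_vec (z j))"
  obtain L where L: "L \<ge> 0" "\<And>x y. \<bar>f x - f y\<bar> \<le> L * orbit_dist G x y"
    using invariant_tropical_rational_lipschitz[OF f] by blast
  obtain C where C: "C \<ge> 0" "\<And>x y. eps ?N x = eps ?N y \<Longrightarrow>
      orbit_dist G x y \<le> C * (\<Sum>j\<in>{1..2 * ?N}. \<bar>?f j x - ?f j y\<bar>)"
    using orbit_dist_le_filter_diffs[OF good] by blast
  obtain m where m: "L * C \<le> real m" using real_arch_simple by blast
  (* The value eps 0 = 0 is not in the list w; it is supplied by the case k = 0 in e. *)
  define h where "h j = (if j \<le> 2 * ?N then ?f j else eps (j - 2 * ?N))" for j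
  define e where "e w k = (if k = 0 then 0 else w (2 * ?N + k))" for w :: "nat \<Rightarrow> real" and k
  define piece where "piece \<rho> w = f (arrange \<rho> (e w))
      + real m * (\<Sum>j\<in>{1..2 * ?N}. \<bar>w j - ?f j (arrange \<rho> (e w))\<bar>)" for \<rho> w
  define g where "g w = Min ((\<lambda>\<rho>. piece \<rho> w) ` ?R)" for w
  have R: "?R \<noteq> {}" using ex_ranking[of "0 :: real ^ 'n"] by blast
  have compose: "tropical_rational {1..3 * ?N} (\<lambda>w. p (arrange \<rho> (e w)))"
    if p: "p \<in> inv_tropical_rationals G" and \<rho>: "\<rho> \<in> ?R" for p \<rho>
  proof -
    have "tropical_rational {1..3 * ?N} (\<lambda>w. e w k)" if "k \<le> ?N" for k
      using that unfolding e_def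
      by (cases "k = 0") (auto intro: tropical_rational_const tropical_rational_coordinate)
    moreover have "\<rho> i \<le> ?N" for i
      using bij_betwE[of \<rho> UNIV "{1..?N}"] \<rho> by auto
    then have "\<rho> i \<le> ?N" "\<rho> i - 1 \<le> ?N" for i
      using le_trans[OF diff_le_self] by blast+
    ultimately have "tropical_rational {1..3 * ?N} (\<lambda>w. e w (\<rho> i) - e w (\<rho> i - 1))" for i
      by (intro tropical_rational_diff) blast+
    moreover have "tropical_rational UNIV (\<lambda>v. p (\<chi> i. v i))"
      using p by (simp add: inv_tropical_rationals_def)
    ultimately show ?thesis
      unfolding arrange_def
      using tropical_rational_compose[of UNIV "\<lambda>v. p (\<chi> i. v i)" "{1..3 * ?N}"
          "\<lambda>i w. e w (\<rho> i) - e w (\<rho> i - 1)"] by blast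
  qed
  have diff: "tropical_rational {1..3 * ?N} (\<lambda>w. \<bar>w j - ?f j (arrange \<rho> (e w))\<bar>)"
    if "\<rho> \<in> ?R" "j \<in> {1..2 * ?N}" for \<rho> j
  proof -
    have "?f j \<in> inv_tropical_rationals G"
      using inv_tropical_polynomials_subset max_filter_mem by blast
    note compose[OF this that(1)]
    moreover have "tropical_rational {1..3 * ?N} (\<lambda>w. w j)"
      using that(2) by (intro tropical_rational_coordinate) auto
    ultimately show ?thesis by (intro tropical_rational_abs tropical_rational_diff)
  qed
  have piece_fun: "piece \<rho> = (\<lambda>w. f (arrange \<rho> (e w))
      + real m * (\<Sum>j\<in>{1..2 * ?N}. \<bar>w j - ?f j (arrange \<rho> (e w))\<bar>))" for \<rho>
    by (simp add: piece_def fun_eq_iff)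
  have "tropical_rational {1..3 * ?N} (piece \<rho>)" if "\<rho> \<in> ?R" for \<rho>
    unfolding piece_fun
    by (rule tropical_rational_add[OF compose[OF f that]
          tropical_rational_nat_mult[OF tropical_rational_sum[OF diff[OF that]]]])
  then have "tropical_rational {1..3 * ?N} g"
    unfolding g_def by (rule tropical_rational_Min[OF finite_rankings R])
  moreover have "h j \<in> generators G z" if "j \<in> {1..3 * ?N}" for j
  proof (cases "j \<le> 2 * ?N")
    case True
    then show ?thesis using that by (auto simp: h_def generators_def)
  next
    case False
    then have "j - 2 * ?N \<in> {1..?N}" using that by auto
    then show ?thesis using False by (simp add: h_def generators_def)
  qed
  moreover have "f x = g (\<lambda>j. h j x)" for x
  proof -
    have e: "e (\<lambda>j. h j x) = (\<lambda>k. eps k x)"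
      by (auto simp: e_def h_def eps_0 fun_eq_iff)
    have piece: "piece \<rho> (\<lambda>j. h j x) = f (arrange \<rho> (\<lambda>k. eps k x))
      + real m * (\<Sum>j\<in>{1..2 * ?N}. \<bar>?f j x - ?f j (arrange \<rho> (\<lambda>k. eps k x))\<bar>)" for \<rho>
      unfolding piece_def e by (simp add: h_def)
    have "g (\<lambda>j. h j x) = f x"
      unfolding g_def
    proof (rule Min_eqI)
      show "finite ((\<lambda>\<rho>. piece \<rho> (\<lambda>j. h j x)) ` ?R)" by (intro finite_imageI finite_rankings)
    next
      fix t assume "t \<in> (\<lambda>\<rho>. piece \<rho> (\<lambda>j. h j x)) ` ?R"
      then obtain \<rho> where \<rho>: "\<rho> \<in> ?R" and t: "t = piece \<rho> (\<lambda>j. h j x)" by auto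
      define y where "y = arrange \<rho> (\<lambda>k. eps k x)"
      have "eps ?N x = eps ?N y"
        using \<rho> sum_arrange[of \<rho> "\<lambda>k. eps k x"] by (simp add: y_def eps_CARD[of y] eps_CARD eps_0)
      (* x and y have equal coordinate sums, so the filter differences bound their distance. *)
      then have "L * orbit_dist G x y \<le> L * (C * (\<Sum>j\<in>{1..2 * ?N}. \<bar>?f j x - ?f j y\<bar>))"
        using C(2) L(1) by (intro mult_left_mono) auto
      also have "\<dots> \<le> real m * (\<Sum>j\<in>{1..2 * ?N}. \<bar>?f j x - ?f j y\<bar>)"
        using m by (simp add: mult.assoc[symmetric] mult_right_mono sum_nonneg)
      finally show "f x \<le> t"
        using L(2)[of x y] unfolding t piece y_def[symmetric] by linarith
    next
      obtain \<rho> where \<rho>: "bij_betw \<rho> UNIV {1..?N}" "\<And>i j. \<rho> i \<le> \<rho> j \<Longrightarrow> x $ j \<le> x $ i"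
        using ex_ranking[of x] by blast
      have "arrange \<rho> (\<lambda>k. eps k x) = x"
        using coordinate_eq_eps_diff[OF \<rho>] by (simp add: arrange_def vec_eq_iff)
      then have "piece \<rho> (\<lambda>j. h j x) = f x" by (simp add: piece)
      then show "f x \<in> (\<lambda>\<rho>. piece \<rho> (\<lambda>j. h j x)) ` ?R" using \<rho>(1) by force
    qed
    then show ?thesis by simp
  qed
  ultimately show "\<exists>k h g. (\<forall>j\<in>{1..k::nat}. h j \<in> generators G z) \<and>
      tropical_rational {1..k} g \<and> (\<forall>x. f x = g (\<lambda>j. h j x))"
    by (intro exI[of _ "3 * ?N"] exI[of _ h] exI[of _ g]) simp
qed

section \<open>The lower bound on the number of generators\<close>

lemma generating_separates:
  assumes "generating G S" "\<And>h. h \<in> S \<Longrightarrow> h x = h y" "f \<in> inv_tropical_rationals G"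
  shows "f x = f y"
proof -
  obtain k h g where h: "\<And>j. j \<in> {1..k::nat} \<Longrightarrow> h j \<in> S" and g: "tropical_rational {1..k} g"
    and f: "\<And>x. f x = g (\<lambda>j. h j x)"
    using assms(1,3) unfolding generating_def by blast
  show ?thesis
    unfolding f by (rule tropical_rational_cong[OF g]) (use h assms(2) in blast)
qed

text \<open>If there are fewer than \<open>N\<close> generators, they can be placed on some of the coordinates so that
  at least one coordinate \<open>l\<close> stays free. The resulting map \<open>\<Theta>\<close> embeds an open set into the proper
  subspace where coordinate \<open>l\<close> vanishes.\<close>

lemma card_generating:
  assumes gen: "generating G S" and "finite S"
  shows "CARD('n) \<le> card S"
proof (rule ccontr)
  assume "\<not> CARD('n) \<le> card S"
  then have less: "card S < CARD('n)" by simp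
  obtain \<rho> :: "'n \<Rightarrow> nat" where \<rho>: "bij_betw \<rho> UNIV {1..CARD('n)}"
    using ex_ranking[of "0 :: real ^ 'n"] by blast
  then have inj: "inj \<rho>" by (simp add: bij_betw_def)
  define U where "U = {x :: real ^ 'n. \<forall>i j. \<rho> i < \<rho> j \<longrightarrow> x $ j < x $ i}"
  have "U = (\<Inter>p\<in>{(i, j). \<rho> i < \<rho> j}. {x. x $ snd p < x $ fst p})"
    by (auto simp: U_def)
  then have "open U"
    by (auto intro!: open_INT open_Collect_less continuous_intros)
  have "(\<chi> i. - real (\<rho> i)) \<in> U" by (simp add: U_def)
  then have "U \<noteq> {}" by blast
  obtain e :: "(real ^ 'n \<Rightarrow> real) \<Rightarrow> 'n" where e: "inj_on e S"
    using card_le_inj[of S "UNIV :: 'n set"] \<open>finite S\<close> less by auto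
  have "e ` S \<noteq> UNIV" using less card_image[OF e] by auto
  then obtain l where l: "l \<notin> e ` S" by blast
  define V where "V = {y :: real ^ 'n. y $ l = 0}"
  have "subspace V" by (auto simp: V_def subspace_def)
  define \<Theta> where "\<Theta> x = (\<chi> i. if i \<in> e ` S then inv_into S e i x else 0)" for x
  have \<Theta>: "\<Theta> x $ e h = h x" if "h \<in> S" for h x
    using that e by (simp add: \<Theta>_def)
  have "continuous_on U h" if "h \<in> S" for h
  proof -
    have "h \<in> inv_tropical_rationals G" using gen that by (auto simp: generating_def)
    then obtain L where "L \<ge> 0" "\<And>x y. \<bar>h x - h y\<bar> \<le> L * norm (x - y)"
      using tropical_rational_lipschitz[of h] by (auto simp: inv_tropical_rationals_def)
    then have "L-lipschitz_on U h"
      by (auto intro!: lipschitz_onI simp: dist_norm)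
    then show ?thesis by (rule lipschitz_on_continuous_on)
  qed
  then have "continuous_on U (\<lambda>x. if i \<in> e ` S then inv_into S e i x else 0)" for i
    by (cases "i \<in> e ` S") (simp_all add: inv_into_into)
  then have "continuous_on U \<Theta>"
    unfolding \<Theta>_def by (rule continuous_on_vec_lambda)
  moreover have "inj_on \<Theta> U"
  proof (rule inj_onI)
    fix x y assume x: "x \<in> U" and y: "y \<in> U" and eq: "\<Theta> x = \<Theta> y"
    have "h x = h y" if "h \<in> S" for h
      using \<Theta>[OF that, of x] \<Theta>[OF that, of y] eq by simp
    then have eps: "eps k x = eps k y" if "k \<le> CARD('n)" for k
      using generating_separates[OF gen] eps_mem[OF that] inv_tropical_polynomials_subset by blast
    have sorted: "u $ j \<le> u $ i" if "u \<in> U" "\<rho> i \<le> \<rho> j" for u i j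
      using that inj by (cases "i = j") (auto simp: U_def le_less dest: injD)
    have "x $ i = y $ i" for i
    proof -
      have "\<rho> i \<le> CARD('n)" using \<rho> by (auto simp: bij_betw_def)
      then show ?thesis
        using coordinate_eq_eps_diff[OF \<rho>, of x i] coordinate_eq_eps_diff[OF \<rho>, of y i]
          sorted[OF x] sorted[OF y] eps[of "\<rho> i"] eps[of "\<rho> i - 1"] by simp
    qed
    then show "x = y" by (simp add: vec_eq_iff)
  qed
  moreover have "\<Theta> \<in> U \<rightarrow> V" using l by (simp add: \<Theta>_def V_def)
  ultimately have "dim (UNIV :: (real ^ 'n) set) \<le> dim V"
    using \<open>open U\<close> \<open>U \<noteq> {}\<close> \<open>subspace V\<close>
    by (intro invariance_of_dimension_subspaces[of UNIV U V \<Theta>]) auto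
  moreover have "axis l 1 \<notin> V" by (simp add: V_def)
  then have "V \<subset> UNIV" by blast
  then have "dim V < dim (UNIV :: (real ^ 'n) set)"
    using \<open>subspace V\<close> by (intro dim_psubset) (simp add: span_eq_iff[THEN iffD2])
  ultimately show False by simp
qed

end

theorem corollary4p5:
  fixes G :: "('n::finite \<Rightarrow> 'n) set"
  assumes "subgroup G (BijGroup (UNIV :: 'n set))"
  shows "(\<exists>z :: nat \<Rightarrow> nat ^ 'n. good_templates G z) \<and>
         (\<forall>z :: nat \<Rightarrow> nat ^ 'n. good_templates G z \<longrightarrow>
            generators G z \<subseteq> inv_tropical_polynomials G \<and> generating G (generators G z)) \<and>
         (\<forall>S. generating G S \<longrightarrow> infinite S \<or> CARD('n) \<le> card S)"
proof -
  interpret permutation_group G by (rule permutation_group.intro) (rule assms)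
  show ?thesis
    using ex_good_templates generators_subset generating_generators card_generating by blast
qed

end
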